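(* Let $\boldsymbol{g}=(g_1,\ldots,g_k)$ and $F=(f_1,\ldots,f_n)$ be two sequences of polynomials in $\mathbb{Q}[x_1,\ldots,x_n]$. On input $(\boldsymbol{g},F)$, the algorithm $\mathsf{InvariantSet}$ (described in the context) terminates and outputs a finite sequence of polynomials whose common vanishing set in $\mathbb{C}^n$ is the invariant set $S_{(F,\mathbf{V}(g_1,\ldots,g_k))}$.
   Context: Notation: $\mathbf{x}=(x_1,\ldots,x_n)$; $\mathbf{V}(S)\subset\mathbb{C}^n$ is the common zero set in $\mathbb{C}^n$ of a set $S$ of polynomials. A tuple $F=(f_1,\ldots,f_n)$ of polynomials in $\mathbf{x}$ is identified with the map $F:\mathbb{C}^n\to\mathbb{C}^n$ it defines. $F^0=\mathrm{id}$ and $F^m=F\circ F^{m-1}$. Invariant set: for a map $F:\mathbb{C}^n\to\mathbb{C}^n$ and $X\subset\mathbb{C}^n$, $S_{(F,X)}=\{x\in X\mid \forall m\in\mathbb{N},\ F^m(x)\in X\}$. Algorithm $\mathsf{InvariantSet}$, on input sequences $\boldsymbol{g}=(g_1,\ldots,g_k)$ and $F=(f_1,\ldots,f_n)$ in $\mathbb{Q}[\mathbf{x}]$: (1) set $S\leftarrow\{g_1,\ldots,g_k\}$; (2) set $\widetilde{\boldsymbol{g}}\leftarrow(g_1\circ F,\ldots,g_k\circ F)$; (3) while it is not the case that all polynomials in $\widetilde{\boldsymbol{g}}$ belong to the radical of the ideal generated by $S$: replace $S$ by $S\cup\{\widetilde{\boldsymbol{g}}\}$ (adding all entries of $\widetilde{\boldsymbol{g}}$),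 then replace $\widetilde{\boldsymbol{g}}$ by the sequence obtained by composing each of its entries with $F$; (4) return $S$. (The radical membership test is performed by an exact decision procedure.) *)

theory Defs
  imports
    "HOL-Analysis.Finite_Cartesian_Product"
    "HOL-Library.Poly_Mapping"
    "HOL-Library.While_Combinator"
begin

text \<open>
  The polynomial ring over \<open>'a\<close> in the \<open>CARD('n)\<close> variables indexed by \<open>'n\<close>: a finitely supported
  map from exponent vectors to coefficients, with the convolution product of
  \<^theory>\<open>HOL-Library.Poly_Mapping\<close>.
\<close>

type_synonym ('n, 'a) mpoly = "('n \<Rightarrow>\<^sub>0 nat) \<Rightarrow>\<^sub>0 'a"

definition const_poly :: "'a::zero \<Rightarrow> ('n, 'a) mpoly"
  where "const_poly c = Poly_Mapping.single 0 c"

text \<open>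
  The value at \<open>x\<close> of the polynomial obtained from \<open>p\<close> by mapping its coefficients with \<open>\<phi>\<close>.
  Evaluation at complex points and substitution of polynomials are the cases
  \<open>\<phi> = of_rat\<close> and \<open>\<phi> = const_poly\<close>.
\<close>

definition eval_via :: "('a::zero \<Rightarrow> 'b::comm_semiring_1) \<Rightarrow> ('n::finite, 'a) mpoly \<Rightarrow> 'b ^ 'n \<Rightarrow> 'b"
  where "eval_via \<phi> p x =
    (\<Sum>m\<in>Poly_Mapping.keys p. \<phi> (Poly_Mapping.lookup p m) *
       (\<Prod>i\<in>UNIV. (x $ i) ^ Poly_Mapping.lookup m i))"

abbreviation eval_complex :: "('n::finite, rat) mpoly \<Rightarrow> complex ^ 'n \<Rightarrow> complex"
  where "eval_complex \<equiv> eval_via of_rat"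

definition compose :: "('n::finite, rat) mpoly \<Rightarrow> ('n, rat) mpoly ^ 'n \<Rightarrow> ('n, rat) mpoly"
  where "compose p F = eval_via const_poly p F"

definition poly_map :: "('n::finite, rat) mpoly ^ 'n \<Rightarrow> complex ^ 'n \<Rightarrow> complex ^ 'n"
  where "poly_map F x = (\<chi> i. eval_complex (F $ i) x)"

definition zero_set :: "('n::finite, rat) mpoly set \<Rightarrow> (complex ^ 'n) set"
  where "zero_set S = {x. \<forall>p\<in>S. eval_complex p x = 0}"

definition invariant_set :: "('s \<Rightarrow> 's) \<Rightarrow> 's set \<Rightarrow> 's set"
  where "invariant_set F X = {x \<in> X. \<forall>m. (F ^^ m) x \<in> X}"

text \<open>A commutative ring is a module over itself, and its submodules are its ideals.\<close>

interpretation ring_self: module "(*) :: 'a::comm_ring_1 \<Rightarrow> 'a \<Rightarrow> 'a"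
  by unfold_locales (simp_all add: algebra_simps)

definition ideal_gen :: "'a::comm_ring_1 set \<Rightarrow> 'a set"
  where "ideal_gen S = module.span (*) S"

definition radical :: "'a::comm_ring_1 set \<Rightarrow> 'a set"
  where "radical I = {p. \<exists>m>0. p ^ m \<in> I}"

text \<open>
  The state of the loop is the pair of the current set \<open>S\<close> and the current sequence \<open>gt\<close>;
  the result is \<^const>\<open>None\<close> exactly if the loop does not terminate.
  The radical membership test is a single step of the algorithm.
\<close>

definition InvariantSet ::
    "('n::finite, rat) mpoly list \<Rightarrow> ('n, rat) mpoly ^ 'n \<Rightarrow> ('n, rat) mpoly set option"
  where "InvariantSet g F = map_option fst
    (while_option
       (\<lambda>(S, gt). \<not> (\<forall>p\<in>set gt. p \<in> radical (ideal_gen S)))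
       (\<lambda>(S, gt). (S \<union> set gt, map (\<lambda>p. compose p F) gt))
       (set g, map (\<lambda>p. compose p F) g))"

end

theory Submission
  imports Defs
begin

text \<open>
  Let \<open>S\<close> be the set of all \<open>g\<^sub>i \<circ> F\<^sup>j\<close> with \<open>j \<le> m\<close>. If all \<open>g\<^sub>i \<circ> F\<^sup>m\<^sup>+\<^sup>1\<close> lie in the radical of the
  ideal generated by \<open>S\<close>, then they vanish on the zero set of \<open>S\<close>, so \<open>F\<close> maps this zero set into
  itself, and therefore it is the invariant set. As long as the test fails, the ideal generated
  by \<open>S\<close> grows strictly, which can only happen finitely often by Hilbert's basis theorem.

  For the latter, choose in each step of a strictly ascending chain of ideals a new element with
  minimal leading monomial. By Dickson's lemma, one of these leading monomials divides a later
  one; cancelling the later leading term produces a new element with a smaller leading monomial.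
\<close>

section \<open>Hilbert's basis theorem\<close>

text \<open>Some subsequence is monotone; if it decreases, it is constant from the index of its
  least value on.\<close>

lemma nat_seq_incseq_subseq:
  fixes s :: "nat \<Rightarrow> nat"
  shows "\<exists>r. strict_mono r \<and> incseq (\<lambda>k. s (r k))"
proof -
  obtain f where f: "strict_mono f" "monoseq (\<lambda>k. s (f k))"
    using seq_monosub by blast
  show ?thesis
  proof (cases "incseq (\<lambda>k. s (f k))")
    case False
    with f have dec: "\<And>i j. i \<le> j \<Longrightarrow> s (f j) \<le> s (f i)"
      by (auto simp: monoseq_def incseq_def)
    obtain n where n: "\<And>k. s (f n) \<le> s (f k)"
      using ex_has_least_nat[of "\<lambda>_. True" 0 "\<lambda>k. s (f k)"] by auto
    have "s (f (n + k)) = s (f n)" for k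
      by (meson dec le_add1 n order_antisym)
    moreover have "strict_mono (\<lambda>k. f (n + k))"
      using f(1) by (auto simp: strict_mono_def)
    ultimately show ?thesis
      by (intro exI[of _ "\<lambda>k. f (n + k)"]) (auto simp: incseq_def)
  qed (use f in blast)
qed

text \<open>Coordinates are treated one at a time: each passes to a further subsequence, and those
  already monotone stay so. The first two terms of the last subsequence are then comparable.\<close>

lemma Dickson:
  fixes m :: "nat \<Rightarrow> 'n::finite \<Rightarrow> nat"
  obtains i j where "i < j" "m i \<le> m j"
proof -
  have "\<exists>r. strict_mono r \<and> (\<forall>x\<in>A. incseq (\<lambda>k. m (r k) x))" if "finite A" for A :: "'n set"
    using that
  proof induction
    case empty
    show ?case
      by (intro exI[of _ id]) (simp add: strict_mono_def)
  next
    case (insert x A)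
    then obtain r where r: "strict_mono r" "\<forall>x\<in>A. incseq (\<lambda>k. m (r k) x)"
      by blast
    obtain r' where r': "strict_mono r'" "incseq (\<lambda>k. m (r (r' k)) x)"
      using nat_seq_incseq_subseq[of "\<lambda>k. m (r k) x"] by blast
    have "\<forall>y\<in>A. incseq (\<lambda>k. m (r (r' k)) y)"
      using r(2) r'(1) by (auto simp: incseq_def strict_mono_less_eq)
    moreover have "strict_mono (\<lambda>k. r (r' k))"
      using r(1) r'(1) by (simp add: strict_mono_def)
    ultimately show ?case
      using r'(2) by blast
  qed
  from this[of UNIV] obtain r where r: "strict_mono r" "\<And>x. incseq (\<lambda>k. m (r k) x)"
    by auto
  have "r 0 < r 1"
    using r(1) by (simp add: strict_mono_less)
  moreover have "m (r 0) \<le> m (r 1)"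
    using r(2) by (auto simp: le_fun_def incseq_def)
  ultimately show ?thesis
    by (rule that)
qed

section \<open>Monomial orders and leading monomials\<close>

lemma lenlex_map_add:
  fixes f g h :: "'a \<Rightarrow> nat"
  assumes "(map f xs, map g xs) \<in> lenlex less_than"
  shows "(map (\<lambda>x. h x + f x) xs, map (\<lambda>x. h x + g x) xs) \<in> lenlex less_than"
  using assms by (induction xs) (auto simp: Cons_lenlex_iff)

lemma monomial_order_exists:
  obtains R :: "(('n::finite \<Rightarrow>\<^sub>0 nat) \<times> ('n \<Rightarrow>\<^sub>0 nat)) set"
  where "wf R" "trans R" "total R" "\<And>a b c. (a, b) \<in> R \<Longrightarrow> (c + a, c + b) \<in> R"
proof -
  obtain xs :: "'n list" where xs: "set xs = UNIV"
    using finite_list[of "UNIV :: 'n set"] by auto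
  define key :: "('n \<Rightarrow>\<^sub>0 nat) \<Rightarrow> nat list" where "key m = map (Poly_Mapping.lookup m) xs" for m
  \<comment> \<open>\<open>xs\<close> may repeat variables; injectivity only uses that each one
    occurs.\<close>
  have inj: "inj key"
    by (rule injI, rule poly_mapping_eqI) (use xs in \<open>auto simp: key_def\<close>)
  define R where "R = inv_image (lenlex less_than) key"
  show ?thesis
  proof
    show "wf R" "trans R"
      by (auto simp: R_def intro: trans_inv_image)
    have "total (lenlex less_than)"
      by (intro total_lenlex) (auto simp: total_on_def)
    with inj show "total R"
      by (auto simp: R_def total_on_def inj_eq)
    show "(c + a, c + b) \<in> R" if "(a, b) \<in> R" for a b c
      using that lenlex_map_add[of _ xs] by (simp add: R_def key_def lookup_add[abs_def])
  qed
qed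

text \<open>A relation rather than a function, so the zero polynomial simply has no leading
  monomial.\<close>

definition leading :: "('m \<times> 'm) set \<Rightarrow> ('m \<Rightarrow>\<^sub>0 'a::zero) \<Rightarrow> 'm \<Rightarrow> bool"
  where "leading R p m \<longleftrightarrow> m \<in> Poly_Mapping.keys p \<and> (\<forall>m'\<in>Poly_Mapping.keys p. m' = m \<or> (m', m) \<in> R)"

lemma leading_exists:
  assumes "trans R" "total R" "p \<noteq> 0"
  obtains m where "leading R p m"
proof -
  have "\<exists>m\<in>A. \<forall>m'\<in>A. m' = m \<or> (m', m) \<in> R" if "finite A" "A \<noteq> {}" for A
    using that
  proof (induction rule: finite_ne_induct)
    case (insert x A)
    then obtain m where m: "m \<in> A" "\<forall>m'\<in>A. m' = m \<or> (m', m) \<in> R"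
      by blast
    show ?case
    proof (cases "x = m \<or> (x, m) \<in> R")
      case False
      with \<open>total R\<close> have "(m, x) \<in> R"
        by (auto simp: total_on_def)
      with m \<open>trans R\<close> have "\<forall>m'\<in>A. (m', x) \<in> R"
        by (metis transD)
      then show ?thesis
        by blast
    qed (use m in auto)
  qed simp
  moreover have "Poly_Mapping.keys p \<noteq> {}"
    using \<open>p \<noteq> 0\<close> by (auto simp: poly_mapping_eq_iff fun_eq_iff in_keys_iff)
  ultimately show ?thesis
    using that unfolding leading_def by (meson finite_keys)
qed

section \<open>Ascending chains of ideals\<close>

text \<open>By cancellation, \<open>m\<close> is the only exponent that the shift by
  \<open>a\<close> carries to \<open>a + m\<close>.\<close>

lemma lookup_single_mult:
  fixes p :: "'m::cancel_comm_monoid_add \<Rightarrow>\<^sub>0 'a::semiring_0"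
  shows "Poly_Mapping.lookup (Poly_Mapping.single a c * p) (a + m) = c * Poly_Mapping.lookup p m"
  by (simp add: lookup_mult lookup_single when_mult)

theorem Hilbert_basis:
  fixes I :: "nat \<Rightarrow> ('n::finite, 'a::field) mpoly set"
  assumes ideal: "\<And>k. module.subspace (*) (I k)" and mono: "\<And>k. I k \<subseteq> I (Suc k)"
  shows "\<exists>k. I (Suc k) = I k"
proof (rule ccontr)
  assume "\<nexists>k. I (Suc k) = I k"
  with mono have strict: "I (Suc k) - I k \<noteq> {}" for k
    by blast
  have mono_le: "I i \<subseteq> I j" if "i \<le> j" for i j
    using mono that by (rule lift_Suc_mono_le)
  obtain R :: "(('n \<Rightarrow>\<^sub>0 nat) \<times> ('n \<Rightarrow>\<^sub>0 nat)) set"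
    where R: "wf R" "trans R" "total R" "\<And>a b c. (a, b) \<in> R \<Longrightarrow> (c + a, c + b) \<in> R"
    using monomial_order_exists by blast
  have nz: "p \<noteq> 0" if "p \<notin> I k" for p k
    using that ring_self.subspace_0[OF ideal] by blast
  have "\<exists>p m. p \<in> I (Suc k) - I k \<and> leading R p m \<and>
      (\<forall>p' m'. p' \<in> I (Suc k) - I k \<longrightarrow> leading R p' m' \<longrightarrow> (m', m) \<notin> R)" for k
  proof -
    define M where "M = {m. \<exists>p. p \<in> I (Suc k) - I k \<and> leading R p m}"
    obtain p where p: "p \<in> I (Suc k) - I k"
      using strict by blast
    then obtain m where "leading R p m"
      using leading_exists[OF R(2,3)] nz by blast
    with p have "m \<in> M"
      unfolding M_def by blast
    from wfE_min[OF R(1) this] obtain m where "m \<in> M" "\<And>m'. (m', m) \<in> R \<Longrightarrow> m' \<notin> M"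
      by metis
    then show ?thesis
      unfolding M_def by blast
  qed
  then obtain q m where q: "\<And>k. q k \<in> I (Suc k) - I k" and lead: "\<And>k. leading R (q k) (m k)"
    and min: "\<And>k p' m'. p' \<in> I (Suc k) - I k \<Longrightarrow> leading R p' m' \<Longrightarrow> (m', m k) \<notin> R"
    by metis
  obtain i j where "i < j" and le: "Poly_Mapping.lookup (m i) \<le> Poly_Mapping.lookup (m j)"
    using Dickson[of "\<lambda>k. Poly_Mapping.lookup (m k)"] .
  \<comment> \<open>The truncated subtraction is exact because of \<open>le\<close>, so
    \<open>a\<close> is the quotient of the two monomials.\<close>
  define a where "a = m j - m i"
  have mj: "m j = a + m i"
    by (rule poly_mapping_eqI) (use le in \<open>simp add: a_def lookup_add lookup_minus le_fun_def\<close>)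
  \<comment> \<open>This factor makes the coefficients at \<open>m j\<close> cancel in
    \<open>r\<close>.\<close>
  define c where "c = Poly_Mapping.lookup (q j) (m j) / Poly_Mapping.lookup (q i) (m i)"
  define r where "r = q j - Poly_Mapping.single a c * q i"
  \<comment> \<open>Since \<open>Suc i \<le> j\<close>, the subtracted multiple already lies in
    \<open>I j\<close>, so \<open>r\<close> is as new at step \<open>j\<close> as
    \<open>q j\<close>.\<close>
  have "q i \<in> I j"
    using q[of i] mono_le[of "Suc i" j] \<open>i < j\<close> by auto
  then have cq: "Poly_Mapping.single a c * q i \<in> I j"
    by (rule ring_self.subspace_scale[OF ideal])
  have "r \<in> I (Suc j)"
    unfolding r_def using q[of j] cq mono by (intro ring_self.subspace_diff[OF ideal]) auto
  moreover have "r \<notin> I j"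
  proof
    assume "r \<in> I j"
    from ring_self.subspace_add[OF ideal this cq] q[of j] show False
      by (simp add: r_def)
  qed
  ultimately have r: "r \<in> I (Suc j) - I j"
    by blast
  obtain m' where m': "leading R r m'"
    using leading_exists[OF R(2,3)] nz[OF \<open>r \<notin> I j\<close>] by blast
  have "Poly_Mapping.lookup (q i) (m i) \<noteq> 0"
    using lead[of i] by (auto simp: leading_def)
  then have "Poly_Mapping.lookup r (m j) = 0"
    by (simp add: r_def lookup_minus mj lookup_single_mult c_def)
  with m' have "m' \<noteq> m j"
    by (auto simp: leading_def)
  have "m' \<in> Poly_Mapping.keys (q j) \<or> m' \<in> Poly_Mapping.keys (Poly_Mapping.single a c * q i)"
    using m' by (auto simp: leading_def r_def in_keys_iff lookup_minus)
  \<comment> \<open>Translation invariance keeps the shifted terms of \<open>q i\<close> at or below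
    \<open>a + m i\<close>, which is \<open>m j\<close>.\<close>
  then have "m' = m j \<or> (m', m j) \<in> R"
  proof
    assume "m' \<in> Poly_Mapping.keys (Poly_Mapping.single a c * q i)"
    then obtain b where "m' = a + b" "b \<in> Poly_Mapping.keys (q i)"
      using keys_mult[of "Poly_Mapping.single a c" "q i"] by (auto split: if_splits)
    with lead[of i] R(4) show ?thesis
      by (auto simp: leading_def mj)
  qed (use lead[of j] in \<open>auto simp: leading_def\<close>)
  with \<open>m' \<noteq> m j\<close> min[OF r m'] show False
    by blast
qed

section \<open>Evaluation\<close>

lemma poly_mapping_plus_induct [case_names zero plus]:
  assumes "P 0" "\<And>p a b. P p \<Longrightarrow> P (p + Poly_Mapping.single a b)"
  shows "P (p :: 'm \<Rightarrow>\<^sub>0 'a::monoid_add)"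
proof (induction p rule: update_induct)
  case (update p a b)
  have "Poly_Mapping.update a b p = p + Poly_Mapping.single a b"
    using update(1)
    by (intro poly_mapping_eqI) (auto simp: lookup_update lookup_add lookup_single in_keys_iff when_def)
  with assms(2) update show ?case
    by simp
qed (fact assms(1))

text \<open>Serves twice: for the coefficient map \<open>of_rat\<close>, and for evaluation at a
  complex point, which inherits the property.\<close>

locale semiring_hom =
  fixes \<phi> :: "'a::comm_semiring_1 \<Rightarrow> 'b::comm_semiring_1"
  assumes zero: "\<phi> 0 = 0" and one: "\<phi> 1 = 1"
    and add: "\<phi> (a + b) = \<phi> a + \<phi> b" and mult: "\<phi> (a * b) = \<phi> a * \<phi> b"
begin

lemma sum: "\<phi> (\<Sum>i\<in>A. f i) = (\<Sum>i\<in>A. \<phi> (f i))"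
  by (induction A rule: infinite_finite_induct) (simp_all add: zero add)

lemma prod: "\<phi> (\<Prod>i\<in>A. f i) = (\<Prod>i\<in>A. \<phi> (f i))"
  by (induction A rule: infinite_finite_induct) (simp_all add: one mult)

lemma power: "\<phi> (a ^ k) = \<phi> a ^ k"
  by (induction k) (simp_all add: one mult)

lemma eval_via_single:
  "eval_via \<phi> (Poly_Mapping.single m c) x = \<phi> c * (\<Prod>i\<in>UNIV. (x $ i) ^ Poly_Mapping.lookup m i)"
  by (simp add: eval_via_def zero)

lemma eval_via_add: "eval_via \<phi> (p + q) x = eval_via \<phi> p x + eval_via \<phi> q x"
  unfolding eval_via_def
  by (rule setsum_keys_plus_distrib) (simp_all add: zero add distrib_right)

text \<open>Induction on the terms of both factors reduces the claim to products of two
  monomials.\<close>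

lemma eval_via_mult: "eval_via \<phi> (p * q) x = eval_via \<phi> p x * eval_via \<phi> q x"
proof (induction p rule: poly_mapping_plus_induct)
  case zero
  show ?case
    by (simp add: eval_via_def)
next
  case (plus p a b)
  have "eval_via \<phi> (Poly_Mapping.single a b * q) x = eval_via \<phi> (Poly_Mapping.single a b) x * eval_via \<phi> q x"
  proof (induction q rule: poly_mapping_plus_induct)
    case zero
    show ?case
      by (simp add: eval_via_def)
  next
    case (plus q c d)
    then show ?case
      by (simp add: distrib_left eval_via_add mult_single eval_via_single mult lookup_add power_add
        prod.distrib mult_ac)
  qed
  with plus show ?case
    by (simp add: distrib_right eval_via_add)
qed

lemma semiring_hom_eval_via: "semiring_hom (\<lambda>p. eval_via \<phi> p x)"
proof
  show "eval_via \<phi> 1 x = 1"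
    using eval_via_single[of 0 1 x] by (simp add: one)
qed (simp_all add: eval_via_add eval_via_mult, simp add: eval_via_def)

end

interpretation of_rat: semiring_hom "of_rat :: rat \<Rightarrow> 'a::field_char_0"
  by unfold_locales (simp_all add: of_rat_add of_rat_mult)

interpretation eval_complex: semiring_hom "\<lambda>p. eval_complex p x"
  by (rule of_rat.semiring_hom_eval_via)

text \<open>Evaluation at \<open>x\<close> is a homomorphism, so it passes through the sum of
  products that defines substitution.\<close>

lemma eval_complex_compose: "eval_complex (compose p F) x = eval_complex p (poly_map F x)"
proof -
  have "eval_complex (const_poly c) x = of_rat c" for c
    by (simp add: const_poly_def of_rat.eval_via_single)
  then show ?thesis
    by (simp add: compose_def eval_via_def[of const_poly] eval_via_def[of _ p] poly_map_def
      eval_complex.sum eval_complex.mult eval_complex.prod eval_complex.power)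
qed

lemma zero_set_compose:
  "zero_set ((\<lambda>p. compose p F) ` S) = {x. poly_map F x \<in> zero_set S}"
  by (simp add: zero_set_def eval_complex_compose)

lemma zero_set_Un: "zero_set (S \<union> T) = zero_set S \<inter> zero_set T"
  by (auto simp: zero_set_def)

text \<open>The polynomials vanishing at \<open>x\<close> form an ideal containing \<open>S\<close>,
  and a complex number with a zero power is zero.\<close>

lemma radical_ideal_vanishes:
  assumes "p \<in> radical (ideal_gen S)" "x \<in> zero_set S"
  shows "eval_complex p x = 0"
proof -
  have "ring_self.subspace {q. eval_complex q x = 0}"
    by (auto simp: ring_self.subspace_def eval_complex.zero eval_complex.add eval_complex.mult)
  moreover have "S \<subseteq> {q. eval_complex q x = 0}"
    using assms(2) by (auto simp: zero_set_def)
  ultimately have "ideal_gen S \<subseteq> {q. eval_complex q x = 0}"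
    unfolding ideal_gen_def by (intro ring_self.span_minimal)
  with assms(1) show ?thesis
    by (auto simp: radical_def eval_complex.power)
qed

section \<open>The algorithm\<close>

lemma InvariantSet_terminates: "InvariantSet g F \<noteq> None"
proof
  define b where "b = (\<lambda>(S :: ('a, rat) mpoly set, gt). \<not> (\<forall>p\<in>set gt. p \<in> radical (ideal_gen S)))"
  define c where "c = (\<lambda>(S, gt). (S \<union> set gt, map (\<lambda>p. compose p F) gt))"
  define s where "s = (set g, map (\<lambda>p. compose p F) g)"
  assume "InvariantSet g F = None"
  \<comment> \<open>\<open>while_option\<close> yields \<open>None\<close> only if the guard holds
    at every iterate.\<close>
  then have b: "b ((c ^^ k) s)" for k
    by (simp add: InvariantSet_def while_option_def b_def c_def s_def split: if_splits)
  define I where "I k = ideal_gen (fst ((c ^^ k) s))" for k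
  have sub: "fst ((c ^^ k) s) \<union> set (snd ((c ^^ k) s)) = fst ((c ^^ Suc k) s)" for k
    by (simp add: c_def split_beta)
  have "\<exists>k. I (Suc k) = I k"
  proof (rule Hilbert_basis)
    show "ring_self.subspace (I k)" for k
      by (simp add: I_def ideal_gen_def)
    show "I k \<subseteq> I (Suc k)" for k
      unfolding I_def ideal_gen_def using sub[of k] by (intro ring_self.span_mono) blast
  qed
  then obtain k where k: "I (Suc k) = I k"
    by blast
  \<comment> \<open>The pending polynomials enter the next generating set; as the ideal does not
    grow, they lie in \<open>I k\<close> already, and the guard fails.\<close>
  have "p \<in> radical (I k)" if "p \<in> set (snd ((c ^^ k) s))" for p
  proof -
    have "p \<in> I (Suc k)"
      unfolding I_def ideal_gen_def using sub[of k] that by (intro ring_self.span_base) blast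
    with k show ?thesis
      by (auto simp: radical_def intro: exI[of _ 1])
  qed
  with b[of k] show False
    by (auto simp: b_def I_def split_beta)
qed

lemma InvariantSet_correct:
  assumes "InvariantSet g F = Some S"
  shows "finite S" "zero_set S = invariant_set (poly_map F) (zero_set (set g))"
proof -
  let ?Z = "zero_set (set g)" and ?f = "poly_map F"
  \<comment> \<open>The loop invariant: \<open>n\<close> counts completed passes, and the pending
    sequence is one composition ahead. It tracks zero sets instead of the polynomials
    themselves.\<close>
  define P where "P = (\<lambda>(S, gt). finite S \<and> (\<exists>n. zero_set S = {x. \<forall>k\<le>n. (?f ^^ k) x \<in> ?Z} \<and>
    zero_set (set gt) = {x. (?f ^^ Suc n) x \<in> ?Z}))"
  obtain gt where loop: "while_option
       (\<lambda>(S, gt). \<not> (\<forall>p\<in>set gt. p \<in> radical (ideal_gen S)))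
       (\<lambda>(S, gt). (S \<union> set gt, map (\<lambda>p. compose p F) gt))
       (set g, map (\<lambda>p. compose p F) g) = Some (S, gt)"
    using assms by (auto simp: InvariantSet_def)
  have "P (S, gt)"
  proof (rule while_option_rule[OF _ loop])
    show "P (set g, map (\<lambda>p. compose p F) g)"
      by (auto simp: P_def zero_set_compose intro!: exI[of _ 0])
  next
    fix s
    assume "P s"
    then obtain S gt n where "s = (S, gt)" "finite S"
      and S: "zero_set S = {x. \<forall>k\<le>n. (?f ^^ k) x \<in> ?Z}"
      and gt: "zero_set (set gt) = {x. (?f ^^ Suc n) x \<in> ?Z}"
      by (auto simp: P_def)
    moreover have "zero_set (S \<union> set gt) = {x. \<forall>k\<le>Suc n. (?f ^^ k) x \<in> ?Z}"
      unfolding zero_set_Un S gt by (auto simp: le_Suc_eq)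
    moreover have "zero_set (set (map (\<lambda>p. compose p F) gt)) = {x. (?f ^^ Suc (Suc n)) x \<in> ?Z}"
      unfolding set_map zero_set_compose gt by (simp add: funpow_swap1)
    ultimately show "P (case s of (S, gt) \<Rightarrow> (S \<union> set gt, map (\<lambda>p. compose p F) gt))"
      unfolding P_def by (simp only: prod.case finite_Un finite_set) blast
  qed
  then obtain n where "finite S" and S: "zero_set S = {x. \<forall>k\<le>n. (?f ^^ k) x \<in> ?Z}"
    and gt: "zero_set (set gt) = {x. (?f ^^ Suc n) x \<in> ?Z}"
    by (auto simp: P_def)
  show "finite S"
    by fact
  \<comment> \<open>The failed guard puts \<open>gt\<close> into the radical, so iterates in
    \<open>?Z\<close> up to \<open>n\<close> force iterate \<open>Suc n\<close> into
    \<open>?Z\<close>.\<close>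
  have "zero_set S \<subseteq> zero_set (set gt)"
    using while_option_stop[OF loop] radical_ideal_vanishes by (fastforce simp: zero_set_def[of "set gt"])
  then have "(?f ^^ Suc k) x \<in> ?Z" if "x \<in> zero_set S" "k \<le> n" for x k
    using that unfolding S gt by (cases "k = n") (auto simp del: funpow.simps)
  \<comment> \<open>The orbit of \<open>?f x\<close> is that of \<open>x\<close> shifted by one, so
    the zero set is mapped into itself.\<close>
  then have step: "?f x \<in> zero_set S" if "x \<in> zero_set S" for x
    using that unfolding S by (simp add: funpow_swap1)
  have "(?f ^^ k) x \<in> zero_set S" if "x \<in> zero_set S" for x k
    using that step by (induction k) auto
  moreover have "zero_set S \<subseteq> ?Z"
    unfolding S by (metis (mono_tags, lifting) funpow_0 le0 mem_Collect_eq subsetI)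
  ultimately show "zero_set S = invariant_set ?f ?Z"
    by (auto simp: invariant_set_def S)
qed

theorem theorem2p5:
  fixes g :: "('n::finite, rat) mpoly list" and F :: "('n, rat) mpoly ^ 'n"
  shows "\<exists>h :: ('n, rat) mpoly list. InvariantSet g F = Some (set h) \<and>
           zero_set (set h) = invariant_set (poly_map F) (zero_set (set g))"
proof -
  obtain S where S: "InvariantSet g F = Some S"
    using InvariantSet_terminates by blast
  moreover obtain h where "set h = S"
    using finite_list InvariantSet_correct(1)[OF S] by blast
  ultimately show ?thesis
    using InvariantSet_correct(2) by blast
qed

end
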